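(* For all natural numbers $r, n, \delta \geq 2$, there exists a $d$-regular graph $G = G(r,n,\delta)$ with $d > \delta$, $\chi(G) = n$ and $\chi_r(G) = r\,\chi(G)$.
   Context: All graphs are finite and simple. A proper $k$-colouring of a graph $G$ is a map $c\colon V(G)\to[k]$ with $c(u)\neq c(v)$ for every edge $uv$; $\chi(G)$ is the chromatic number. For an integer $r\ge 1$, an $r$-dynamic $k$-colouring of $G$ is a proper $k$-colouring $c$ such that for every vertex $v$, the set $c(N(v))$ of colours used on the neighbourhood $N(v)$ has size at least $\min\{r, d(v)\}$, where $d(v)$ is the degree of $v$. The $r$-dynamic chromatic number $\chi_r(G)$ is the least $k$ such that $G$ has an $r$-dynamic $k$-colouring. *)

theory Defs
  imports Main
begin

definition simple_graph :: "'a set \<Rightarrow> ('a \<Rightarrow> 'a \<Rightarrow> bool) \<Rightarrow> bool" where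
  "simple_graph V E \<longleftrightarrow> finite V \<and> (\<forall>u v. E u v \<longrightarrow> u \<in> V \<and> v \<in> V)
     \<and> (\<forall>u v. E u v \<longrightarrow> E v u) \<and> (\<forall>v. \<not> E v v)"

definition nbhd :: "'a set \<Rightarrow> ('a \<Rightarrow> 'a \<Rightarrow> bool) \<Rightarrow> 'a \<Rightarrow> 'a set" where
  "nbhd V E v = {u \<in> V. E v u}"

definition degree :: "'a set \<Rightarrow> ('a \<Rightarrow> 'a \<Rightarrow> bool) \<Rightarrow> 'a \<Rightarrow> nat" where
  "degree V E v = card (nbhd V E v)"

definition regular :: "'a set \<Rightarrow> ('a \<Rightarrow> 'a \<Rightarrow> bool) \<Rightarrow> nat \<Rightarrow> bool" where
  "regular V E d \<longleftrightarrow> (\<forall>v\<in>V. degree V E v = d)"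

definition proper_colouring :: "'a set \<Rightarrow> ('a \<Rightarrow> 'a \<Rightarrow> bool) \<Rightarrow> nat \<Rightarrow> ('a \<Rightarrow> nat) \<Rightarrow> bool" where
  "proper_colouring V E k c \<longleftrightarrow> (\<forall>v\<in>V. c v \<in> {1..k})
     \<and> (\<forall>u\<in>V. \<forall>v\<in>V. E u v \<longrightarrow> c u \<noteq> c v)"

definition dynamic_colouring :: "nat \<Rightarrow> 'a set \<Rightarrow> ('a \<Rightarrow> 'a \<Rightarrow> bool) \<Rightarrow> nat \<Rightarrow> ('a \<Rightarrow> nat) \<Rightarrow> bool" where
  "dynamic_colouring r V E k c \<longleftrightarrow> proper_colouring V E k c
     \<and> (\<forall>v\<in>V. card (c ` nbhd V E v) \<ge> min r (degree V E v))"

definition chromatic_number :: "'a set \<Rightarrow> ('a \<Rightarrow> 'a \<Rightarrow> bool) \<Rightarrow> nat" where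
  "chromatic_number V E = (LEAST k. \<exists>c. proper_colouring V E k c)"

definition dynamic_chromatic_number :: "nat \<Rightarrow> 'a set \<Rightarrow> ('a \<Rightarrow> 'a \<Rightarrow> bool) \<Rightarrow> nat" where
  "dynamic_chromatic_number r V E = (LEAST k. \<exists>c. dynamic_colouring r V E k c)"

end

theory Submission
  imports Defs
begin

text \<open>
  Take \<open>N\<close> disjoint copies (\<open>blocks\<close>) of the complete \<open>n\<close>-partite graph with parts of size \<open>b\<close>
  and, for every set \<open>S\<close> of \<open>n\<close> blocks and every \<open>i < n\<close>, a hub adjacent to the \<open>i\<close>-th parts of the
  blocks in \<open>S\<close>. Hubs have degree \<open>n b\<close> and the other vertices have degree
  \<open>(n - 1) b + (N - 1 choose n - 1)\<close>, so \<open>b = (N - 1 choose n - 1)\<close> makes the graph regular.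
  The parts of one block use disjoint sets of colours; hence with fewer than \<open>r n\<close> colours every
  block has a part with fewer than \<open>r\<close> colours. If \<open>N\<close> is large compared with \<open>n\<close> and \<open>r\<close>, then
  \<open>n\<close> blocks agree in the index and in the colour set of such a part, and the hub over them sees
  fewer than \<open>r\<close> colours.
\<close>

subsection \<open>Isomorphic copies of a graph\<close>

lemma simple_graphD:
  assumes "simple_graph V E"
  shows "finite V" "E u v \<Longrightarrow> u \<in> V" "E u v \<Longrightarrow> v \<in> V" "E u v \<Longrightarrow> E v u" "\<not> E v v"
  using assms unfolding simple_graph_def by blast+

text \<open>The graph is built on a datatype, but the theorem asks for natural numbers as vertices,
  so it is moved along an injection. The existential keeps edges inside the image, as
  \<open>simple_graph\<close> demands.\<close>

definition image_edge :: "('a \<Rightarrow> 'b) \<Rightarrow> ('a \<Rightarrow> 'a \<Rightarrow> bool) \<Rightarrow> 'b \<Rightarrow> 'b \<Rightarrow> bool" where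
  "image_edge f E u v \<longleftrightarrow> (\<exists>a b. E a b \<and> u = f a \<and> v = f b)"

context
  fixes V :: "'a set" and E and f :: "'a \<Rightarrow> 'b"
  assumes graph: "simple_graph V E" and inj: "inj_on f V"
begin

lemma image_edge_iff: "a \<in> V \<Longrightarrow> b \<in> V \<Longrightarrow> image_edge f E (f a) (f b) \<longleftrightarrow> E a b"
  unfolding image_edge_def using simple_graphD(2,3)[OF graph] inj by (metis inj_onD)

lemma simple_graph_image: "simple_graph (f ` V) (image_edge f E)"
proof -
  have "\<not> image_edge f E v v" for v
    unfolding image_edge_def
    using simple_graphD(2,3,5)[OF graph] inj by (metis inj_onD)
  moreover have "image_edge f E v u" if "image_edge f E u v" for u v
    using that simple_graphD(4)[OF graph] unfolding image_edge_def by blast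
  moreover have "u \<in> f ` V \<and> v \<in> f ` V" if "image_edge f E u v" for u v
    using that simple_graphD(2,3)[OF graph] unfolding image_edge_def by blast
  ultimately show ?thesis
    unfolding simple_graph_def using simple_graphD(1)[OF graph] by blast
qed

lemma nbhd_image: "v \<in> V \<Longrightarrow> nbhd (f ` V) (image_edge f E) (f v) = f ` nbhd V E v"
  unfolding nbhd_def using image_edge_iff by auto

lemma degree_image:
  assumes "v \<in> V"
  shows "degree (f ` V) (image_edge f E) (f v) = degree V E v"
proof -
  have "inj_on f (nbhd V E v)"
    by (rule inj_on_subset[OF inj]) (auto simp: nbhd_def)
  then show ?thesis
    unfolding degree_def nbhd_image[OF assms] by (rule card_image)
qed

lemma regular_image: "regular V E d \<Longrightarrow> regular (f ` V) (image_edge f E) d"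
  by (simp add: regular_def degree_image)

lemma proper_colouring_image:
  "proper_colouring (f ` V) (image_edge f E) k c \<longleftrightarrow> proper_colouring V E k (c \<circ> f)"
  by (simp add: proper_colouring_def image_edge_iff)

lemma dynamic_colouring_image:
  "dynamic_colouring r (f ` V) (image_edge f E) k c \<longleftrightarrow> dynamic_colouring r V E k (c \<circ> f)"
  by (simp add: dynamic_colouring_def proper_colouring_image degree_image nbhd_image image_comp)

text \<open>A colouring \<open>c\<close> of the original graph is carried to the copy as
  \<open>c \<circ> inv_into V f\<close>. Existence for each \<open>k\<close> is all that the
  \<open>LEAST\<close> in the chromatic numbers depends on.\<close>

lemma ex_proper_colouring_image:
  "(\<exists>c. proper_colouring (f ` V) (image_edge f E) k c) \<longleftrightarrow> (\<exists>c. proper_colouring V E k c)"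
proof -
  have "proper_colouring V E k c \<Longrightarrow> proper_colouring V E k ((c \<circ> inv_into V f) \<circ> f)" for c
    by (simp add: proper_colouring_def inv_into_f_f[OF inj])
  then show ?thesis
    unfolding proper_colouring_image by blast
qed

lemma ex_dynamic_colouring_image:
  "(\<exists>c. dynamic_colouring r (f ` V) (image_edge f E) k c) \<longleftrightarrow> (\<exists>c. dynamic_colouring r V E k c)"
proof -
  have "dynamic_colouring r V E k ((c \<circ> inv_into V f) \<circ> f)" if "dynamic_colouring r V E k c" for c
  proof -
    \<comment> \<open>The inverse undoes \<open>f\<close> only on \<open>V\<close>, which suffices
      because neighbourhoods lie in \<open>V\<close>.\<close>
    have "((c \<circ> inv_into V f) \<circ> f) ` nbhd V E v = c ` nbhd V E v" for v
      by (intro image_cong) (auto simp: nbhd_def inv_into_f_f[OF inj])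
    with that show ?thesis
      by (simp add: dynamic_colouring_def proper_colouring_def inv_into_f_f[OF inj])
  qed
  then show ?thesis
    unfolding dynamic_colouring_image by blast
qed

lemma chromatic_number_image: "chromatic_number (f ` V) (image_edge f E) = chromatic_number V E"
  by (simp add: chromatic_number_def ex_proper_colouring_image)

lemma dynamic_chromatic_number_image:
  "dynamic_chromatic_number r (f ` V) (image_edge f E) = dynamic_chromatic_number r V E"
  by (simp add: dynamic_chromatic_number_def ex_dynamic_colouring_image)

end

subsection \<open>Counting\<close>

text \<open>Deleting \<open>x\<close> leaves an arbitrary \<open>m\<close>-subset of
  \<open>A - {x}\<close>. This will count the hubs adjacent to a given core vertex.\<close>

lemma card_subsets_containing:
  assumes "finite A" "x \<in> A"
  shows "card {S. S \<subseteq> A \<and> card S = Suc m \<and> x \<in> S} = (card A - 1) choose m"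
proof -
  have "bij_betw (insert x) {S. S \<subseteq> A - {x} \<and> card S = m}
          {S. S \<subseteq> A \<and> card S = Suc m \<and> x \<in> S}"
  proof (rule bij_betw_byWitness[where f' = "\<lambda>S. S - {x}"])
    show "insert x ` {S. S \<subseteq> A - {x} \<and> card S = m} \<subseteq> {S. S \<subseteq> A \<and> card S = Suc m \<and> x \<in> S}"
    proof (rule image_subsetI)
      fix S assume S: "S \<in> {S. S \<subseteq> A - {x} \<and> card S = m}"
      then have "finite S" "x \<notin> S"
        using assms(1) finite_subset by auto
      with S assms(2) show "insert x S \<in> {S. S \<subseteq> A \<and> card S = Suc m \<and> x \<in> S}"
        by auto
    qed
  qed (use assms in auto)
  then have "card {S. S \<subseteq> A \<and> card S = Suc m \<and> x \<in> S} = card {S. S \<subseteq> A - {x} \<and> card S = m}"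
    by (simp add: bij_betw_same_card)
  also have "\<dots> = (card A - 1) choose m"
    using assms by (simp add: n_subsets)
  finally show ?thesis .
qed

text \<open>By Pascal's rule each step in \<open>t\<close> adds a positive binomial coefficient.
  Hence the part size can be made to exceed any given bound.\<close>

lemma less_binomial_add: "t < (Suc j + t) choose Suc j"
proof (induction t)
  case (Suc t)
  have "0 < (Suc j + t) choose j"
    by simp
  moreover have "(Suc j + Suc t) choose Suc j = ((Suc j + t) choose j) + ((Suc j + t) choose Suc j)"
    by simp
  ultimately show ?case
    using Suc by linarith
qed simp

text \<open>Otherwise the fibres, which cover \<open>A\<close>, would have total size at most
  \<open>card B * n\<close>.\<close>

lemma pigeonhole_fibre:
  assumes "finite A" "g ` A \<subseteq> B" "finite B" "card B * n < card A"
  shows "\<exists>y\<in>B. n < card {x \<in> A. g x = y}"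
proof (rule ccontr)
  assume "\<not> ?thesis"
  then have small: "\<And>y. y \<in> B \<Longrightarrow> card {x \<in> A. g x = y} \<le> n"
    by (simp add: not_less)
  have "A = (\<Union>y\<in>B. {x \<in> A. g x = y})"
    using assms(2) by auto
  then have "card A \<le> (\<Sum>y\<in>B. card {x \<in> A. g x = y})"
    using card_UN_le[OF assms(3), of "\<lambda>y. {x \<in> A. g x = y}"] by simp
  also have "\<dots> \<le> card B * n"
    using sum_bounded_above[of B "\<lambda>y. card {x \<in> A. g x = y}" n] small by simp
  finally show False
    using assms(4) by simp
qed

subsection \<open>The graph\<close>

text \<open>\<open>Core x i p\<close> is the \<open>p\<close>-th vertex in the \<open>i\<close>-th part of block \<open>x\<close>.\<close>

datatype vertex = Core nat nat nat | Hub "nat set" nat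

fun linked :: "vertex \<Rightarrow> vertex \<Rightarrow> bool" where
  "linked (Core x i p) (Core y j q) \<longleftrightarrow> x = y \<and> i \<noteq> j"
| "linked (Core x i p) (Hub S j) \<longleftrightarrow> i = j \<and> x \<in> S"
| "linked (Hub S j) (Core x i p) \<longleftrightarrow> i = j \<and> x \<in> S"
| "linked (Hub S i) (Hub T j) \<longleftrightarrow> False"

lemma linked_sym: "linked u v \<Longrightarrow> linked v u"
  by (induction u v rule: linked.induct) auto

lemma linked_irrefl: "\<not> linked v v"
  by (cases v) auto

definition hub_sets :: "nat \<Rightarrow> nat \<Rightarrow> nat set set" where
  "hub_sets n N = {S. S \<subseteq> {..<N} \<and> card S = n}"

definition verts :: "nat \<Rightarrow> nat \<Rightarrow> nat \<Rightarrow> vertex set" where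
  "verts n N b = (\<lambda>(x, i, p). Core x i p) ` ({..<N} \<times> {..<n} \<times> {..<b})
     \<union> (\<lambda>(S, i). Hub S i) ` (hub_sets n N \<times> {..<n})"

definition edge :: "nat \<Rightarrow> nat \<Rightarrow> nat \<Rightarrow> vertex \<Rightarrow> vertex \<Rightarrow> bool" where
  "edge n N b u v \<longleftrightarrow> u \<in> verts n N b \<and> v \<in> verts n N b \<and> linked u v"

lemma Core_in_verts [simp]: "Core x i p \<in> verts n N b \<longleftrightarrow> x < N \<and> i < n \<and> p < b"
  by (auto simp: verts_def image_iff)

lemma Hub_in_verts [simp]: "Hub S i \<in> verts n N b \<longleftrightarrow> S \<in> hub_sets n N \<and> i < n"
  by (auto simp: verts_def image_iff)

lemma finite_hub_sets: "finite (hub_sets n N)"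
  by (rule finite_subset[of _ "Pow {..<N}"]) (auto simp: hub_sets_def)

lemma simple_graph_edge: "simple_graph (verts n N b) (edge n N b)"
proof -
  have "finite (verts n N b)"
    by (simp add: verts_def finite_hub_sets)
  then show ?thesis
    by (auto simp: simple_graph_def edge_def linked_irrefl intro: linked_sym)
qed

lemma nbhd_Core:
  assumes "Core x i p \<in> verts n N b"
  shows "nbhd (verts n N b) (edge n N b) (Core x i p)
    = (\<lambda>(j, q). Core x j q) ` (({..<n} - {i}) \<times> {..<b}) \<union> (\<lambda>S. Hub S i) ` {S \<in> hub_sets n N. x \<in> S}"
    (is "?L = ?R")
proof (rule set_eqI)
  fix u show "u \<in> ?L \<longleftrightarrow> u \<in> ?R"
    using assms by (cases u) (auto simp: nbhd_def edge_def image_iff)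
qed

lemma nbhd_Hub:
  assumes "Hub S i \<in> verts n N b"
  shows "nbhd (verts n N b) (edge n N b) (Hub S i) = (\<lambda>(x, p). Core x i p) ` (S \<times> {..<b})"
    (is "?L = ?R")
proof (rule set_eqI)
  fix u show "u \<in> ?L \<longleftrightarrow> u \<in> ?R"
    using assms by (cases u) (auto simp: nbhd_def edge_def image_iff hub_sets_def)
qed

lemma regular_edge:
  assumes n: "0 < n" and b: "b = (N - 1) choose (n - 1)"
  shows "regular (verts n N b) (edge n N b) (n * b)"
  unfolding regular_def
proof
  fix v assume v: "v \<in> verts n N b"
  show "degree (verts n N b) (edge n N b) v = n * b"
  proof (cases v)
    case (Core x i p)
    with v have lt: "x < N" "i < n"
      by auto
    \<comment> \<open>The index of an adjacent hub is forced to be \<open>i\<close>, so only its set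
      \<open>S\<close> varies; \<open>b\<close> is chosen to equal this count.\<close>
    have "card {S \<in> hub_sets n N. x \<in> S} = b"
      using card_subsets_containing[of "{..<N}" x "n - 1"] lt n b by (simp add: hub_sets_def conj_assoc)
    moreover have "inj_on (\<lambda>S. Hub S i) A" for A
      by (auto simp: inj_on_def)
    moreover have "card (({..<n} - {i}) \<times> {..<b}) = (n - 1) * b"
      using lt by (simp add: card_cartesian_product)
    moreover have "inj_on (\<lambda>(j, q). Core x j q) A" for A
      by (auto simp: inj_on_def)
    ultimately have "degree (verts n N b) (edge n N b) v = (n - 1) * b + b"
      unfolding degree_def Core nbhd_Core[OF v[unfolded Core]]
      by (subst card_Un_disjoint) (auto simp: card_image finite_hub_sets)
    also have "\<dots> = n * b"
      using n by (cases n) auto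
    finally show ?thesis .
  next
    case (Hub S i)
    with v have "card S = n"
      by (auto simp: hub_sets_def)
    moreover have "inj_on (\<lambda>(x, p). Core x i p) A" for A
      by (auto simp: inj_on_def)
    ultimately show ?thesis
      unfolding degree_def Hub nbhd_Hub[OF v[unfolded Hub]]
      by (simp add: card_image card_cartesian_product)
  qed
qed

subsection \<open>Colouring with \<open>r n\<close> colours\<close>

text \<open>Part \<open>i\<close> of every block runs cyclically through the \<open>i\<close>-th
  interval of \<open>r\<close> colours. A hub over parts \<open>i\<close> takes the first colour of
  the cyclically next interval. \<open>Suc\<close> is there because colours start at 1.\<close>

fun block_colour :: "nat \<Rightarrow> nat \<Rightarrow> vertex \<Rightarrow> nat" where
  "block_colour r n (Core x i p) = Suc (i * r + p mod r)"
| "block_colour r n (Hub S i) = Suc ((Suc i mod n) * r)"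

lemma mult_add_less:
  fixes i a r n :: nat
  assumes "i < n" "a < r"
  shows "i * r + a < r * n"
proof -
  have "i * r + a < Suc i * r"
    using assms by simp
  also have "\<dots> \<le> n * r"
    using assms by (intro mult_le_mono1) simp
  finally show ?thesis
    by (simp add: mult.commute)
qed

lemma part_colours:
  assumes "r \<le> b"
  shows "(\<lambda>a. Suc (i * r + a)) ` {..<r} \<subseteq> block_colour r n ` (\<lambda>p. Core x i p) ` {..<b}"
proof
  fix y assume "y \<in> (\<lambda>a. Suc (i * r + a)) ` {..<r}"
  then obtain a where "a < r" "y = Suc (i * r + a)"
    by auto
  with assms have "y = block_colour r n (Core x i a)" "a < b"
    by auto
  then show "y \<in> block_colour r n ` (\<lambda>p. Core x i p) ` {..<b}"
    by blast
qed

text \<open>Every neighbourhood contains a complete part, and since \<open>r \<le> b\<close> a part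
  shows all \<open>r\<close> colours of its interval.\<close>

lemma dynamic_colouring_block_colour:
  assumes r: "0 < r" "r \<le> b" and n: "2 \<le> n"
  shows "dynamic_colouring r (verts n N b) (edge n N b) (r * n) (block_colour r n)"
proof -
  let ?V = "verts n N b" and ?E = "edge n N b" and ?c = "block_colour r n"
  have ne: "Suc i mod n \<noteq> i" if "i < n" for i
    using that n by (cases "Suc i = n") auto
  \<comment> \<open>Division by \<open>r\<close> recovers the interval from the colour, so distinct
    intervals are disjoint.\<close>
  have div: "(i * r + a) div r = i" if "a < r" for i a
    using that by simp
  have inj: "i = j" if "i * r + a = j * r + a'" "a < r" "a' < r" for i j a a'
    using that div by metis
  have range: "?c v \<in> {1..r * n}" if "v \<in> ?V" for v
  proof (cases v)
    case (Core x i p)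
    with that mult_add_less[of i n "p mod r" r] r show ?thesis
      by simp
  next
    case (Hub S i)
    have "Suc i mod n * r + 0 < r * n"
      using r n by (intro mult_add_less) auto
    then show ?thesis
      unfolding Hub block_colour.simps atLeastAtMost_iff by linarith
  qed
  have neq: "?c u \<noteq> ?c v" if "u \<in> ?V" "v \<in> ?V" "linked u v" for u v
    using that(3,1,2)
  proof (induction u v rule: linked.induct)
    case (1 x i p y j q)
    then show ?case
      using inj[of i "p mod r" j "q mod r"] r by auto
  next
    case (2 x i p S j)
    then show ?case
      using inj[of i "p mod r" "Suc i mod n" 0] ne[of i] r by auto
  next
    case (3 S j x i p)
    then show ?case
      using inj[of i "p mod r" "Suc i mod n" 0] ne[of i] r by auto
  qed simp
  have "r \<le> card (?c ` nbhd ?V ?E v)" if v: "v \<in> ?V" for v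
  proof -
    \<comment> \<open>A core vertex sees the whole next part of its own block; a hub sees part
      \<open>i\<close> of any block in \<open>S\<close>.\<close>
    have "\<exists>x i. (\<lambda>p. Core x i p) ` {..<b} \<subseteq> nbhd ?V ?E v"
    proof (cases v)
      case (Core x i p)
      with v ne[of i] n show ?thesis
        unfolding Core nbhd_Core[OF v[unfolded Core]]
        by (intro exI[of _ x] exI[of _ "Suc i mod n"]) auto
    next
      case (Hub S i)
      with v n have "S \<noteq> {}"
        by (auto simp: hub_sets_def)
      then obtain x where "x \<in> S"
        by blast
      then show ?thesis
        unfolding Hub nbhd_Hub[OF v[unfolded Hub]]
        by (intro exI[of _ x] exI[of _ i]) auto
    qed
    then obtain x i where "(\<lambda>p. Core x i p) ` {..<b} \<subseteq> nbhd ?V ?E v"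
      by blast
    then have sub: "(\<lambda>a. Suc (i * r + a)) ` {..<r} \<subseteq> ?c ` nbhd ?V ?E v"
      using part_colours[OF r(2), of i n x] by (meson image_mono order_trans)
    have "finite (nbhd ?V ?E v)"
      using simple_graphD(1)[OF simple_graph_edge, of n N b] by (simp add: nbhd_def)
    with sub have "card ((\<lambda>a. Suc (i * r + a)) ` {..<r}) \<le> card (?c ` nbhd ?V ?E v)"
      by (intro card_mono) auto
    moreover have "card ((\<lambda>a. Suc (i * r + a)) ` {..<r}) = r"
      by (subst card_image) (auto simp: inj_on_def)
    ultimately show ?thesis
      by simp
  qed
  then have "min r (degree ?V ?E v) \<le> card (?c ` nbhd ?V ?E v)" if "v \<in> ?V" for v
    using that by (simp add: min.coboundedI1)
  then show ?thesis
    unfolding dynamic_colouring_def proper_colouring_def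
    using range neq by (auto simp: edge_def)
qed

subsection \<open>Fewer colours do not suffice\<close>

definition palette :: "(vertex \<Rightarrow> nat) \<Rightarrow> nat \<Rightarrow> nat \<Rightarrow> nat \<Rightarrow> nat set" where
  "palette c b x i = (\<lambda>p. c (Core x i p)) ` {..<b}"

lemma finite_palette: "finite (palette c b x i)"
  by (simp add: palette_def)

lemma palette_subset:
  assumes "proper_colouring (verts n N b) (edge n N b) k c" "x < N" "i < n"
  shows "palette c b x i \<subseteq> {1..k}"
  using assms by (auto simp: palette_def proper_colouring_def simp del: atLeastAtMost_iff)

text \<open>Distinct parts of a block are completely joined, so their palettes are \<open>n\<close>
  disjoint subsets of the \<open>k\<close> colours. With \<open>r = 1\<close> this also bounds the
  ordinary chromatic number.\<close>

lemma palettes_le: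
  assumes proper: "proper_colouring (verts n N b) (edge n N b) k c" and x: "x < N"
    and large: "\<And>i. i < n \<Longrightarrow> r \<le> card (palette c b x i)"
  shows "r * n \<le> k"
proof -
  have disj: "palette c b x i \<inter> palette c b x j = {}" if "i < n" "j < n" "i \<noteq> j" for i j
  proof -
    have "c (Core x i p) \<noteq> c (Core x j q)" if "p < b" "q < b" for p q
    proof -
      have "edge n N b (Core x i p) (Core x j q)"
        using x \<open>i < n\<close> \<open>j < n\<close> \<open>i \<noteq> j\<close> that by (simp add: edge_def)
      with proper show ?thesis
        unfolding proper_colouring_def by (metis edge_def)
    qed
    then show ?thesis
      by (auto simp: palette_def)
  qed
  have "r * n \<le> (\<Sum>i<n. card (palette c b x i))"
    using sum_bounded_below[of "{..<n}" r "\<lambda>i. card (palette c b x i)"] large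
    by (simp add: mult.commute)
  also have "\<dots> = card (\<Union>i<n. palette c b x i)"
    using disj by (intro card_UN_disjoint[symmetric]) (auto simp: finite_palette)
  also have "\<dots> \<le> card {1..k}"
    using palette_subset[OF proper x] by (intro card_mono) auto
  finally show ?thesis
    by simp
qed

lemma dynamic_colouring_lower_bound:
  assumes dyn: "dynamic_colouring r (verts n N b) (edge n N b) k c"
    and n: "0 < n" and b: "b = (N - 1) choose (n - 1)" "r \<le> b"
    and N: "n * 2 ^ (r * n) * n < N"
  shows "r * n \<le> k"
proof (rule ccontr)
  assume k: "\<not> r * n \<le> k"
  let ?V = "verts n N b" and ?E = "edge n N b"
  have proper: "proper_colouring ?V ?E k c"
    using dyn by (simp add: dynamic_colouring_def)
  have "\<forall>x\<in>{..<N}. \<exists>i<n. card (palette c b x i) < r"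
    using palettes_le[OF proper] k by (meson lessThan_iff not_less)
  then obtain part where part: "\<And>x. x < N \<Longrightarrow> part x < n \<and> card (palette c b x (part x)) < r"
    by (metis lessThan_iff)
  \<comment> \<open>Each block is labelled by a part with few colours and its palette. There are
    \<open>n * 2 ^ k\<close> possible labels with \<open>k < r * n\<close>, whence the bound on
    \<open>N\<close>.\<close>
  define g where "g x = (part x, palette c b x (part x))" for x
  have g: "g ` {..<N} \<subseteq> {..<n} \<times> Pow {1..k}"
  proof (rule image_subsetI)
    fix x assume "x \<in> {..<N}"
    then have "x < N" "part x < n"
      using part by auto
    with palette_subset[OF proper] show "g x \<in> {..<n} \<times> Pow {1..k}"
      by (simp add: g_def)
  qed
  have "card ({..<n} \<times> Pow {1..k}) * n = n * 2 ^ k * n"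
    by (simp add: card_cartesian_product card_Pow)
  also have "\<dots> \<le> n * 2 ^ (r * n) * n"
    using k by (intro mult_le_mono power_increasing) auto
  also have "\<dots> < card {..<N}"
    using N by simp
  finally have "card ({..<n} \<times> Pow {1..k}) * n < card {..<N}" .
  then have "\<exists>y\<in>{..<n} \<times> Pow {1..k}. n < card {x \<in> {..<N}. g x = y}"
    using g by (intro pigeonhole_fibre) auto
  then obtain i P where iP: "n < card {x \<in> {..<N}. g x = (i, P)}"
    by auto
  \<comment> \<open>The fibre is trimmed to exactly \<open>n\<close> blocks, since hubs exist only
    over sets of that size.\<close>
  then obtain S where S: "S \<subseteq> {x \<in> {..<N}. g x = (i, P)}" "card S = n"
    by (meson obtain_subset_with_card_n less_imp_le)
  then have S_eq: "x < N" "part x = i" "palette c b x i = P" if "x \<in> S" for x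
    using that by (auto simp: g_def)
  obtain x where x: "x \<in> S"
    using S(2) n by fastforce
  with part S_eq have i: "i < n" and P: "card P < r"
    by blast+
  have hub: "Hub S i \<in> ?V"
    using S i by (auto simp: hub_sets_def)
  have "c ` nbhd ?V ?E (Hub S i) \<subseteq> P"
    unfolding nbhd_Hub[OF hub] using S_eq(3) by (auto simp: palette_def)
  moreover have "finite P"
    using S_eq(3)[OF x] finite_palette by metis
  ultimately have "card (c ` nbhd ?V ?E (Hub S i)) < r"
    using P by (meson card_mono le_less_trans)
  \<comment> \<open>This makes the minimum in the dynamic condition equal to
    \<open>r\<close>.\<close>
  moreover have "r \<le> degree ?V ?E (Hub S i)"
  proof -
    have "degree ?V ?E (Hub S i) = n * b"
      using regular_edge[OF n b(1)] hub by (auto simp: regular_def)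
    moreover have "b \<le> n * b"
      using n by simp
    ultimately show ?thesis
      using b(2) by linarith
  qed
  moreover have "min r (degree ?V ?E (Hub S i)) \<le> card (c ` nbhd ?V ?E (Hub S i))"
    using dyn hub unfolding dynamic_colouring_def by blast
  ultimately show False
    by linarith
qed

text \<open>Both bounds are the case \<open>r = 1\<close>: \<open>block_colour 1 n\<close> gives
  \<open>n\<close> colours, and the nonempty palettes of block 0 force that many.\<close>

lemma chromatic_number_edge:
  assumes "2 \<le> n" "0 < b" "0 < N"
  shows "chromatic_number (verts n N b) (edge n N b) = n"
  unfolding chromatic_number_def
proof (rule Least_equality)
  show "\<exists>c. proper_colouring (verts n N b) (edge n N b) n c"
    using dynamic_colouring_block_colour[of 1 b n N] assms by (auto simp: dynamic_colouring_def)
next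
  fix k assume "\<exists>c. proper_colouring (verts n N b) (edge n N b) k c"
  then obtain c where c: "proper_colouring (verts n N b) (edge n N b) k c"
    by blast
  have "1 \<le> card (palette c b 0 i)" for i
    using assms by (auto simp: palette_def Suc_le_eq card_gt_0_iff)
  then show "n \<le> k"
    using palettes_le[OF c, of 0 1] assms by simp
qed

lemma dynamic_chromatic_number_edge:
  assumes "2 \<le> n" "0 < r" "b = (N - 1) choose (n - 1)" "r \<le> b" "n * 2 ^ (r * n) * n < N"
  shows "dynamic_chromatic_number r (verts n N b) (edge n N b) = r * n"
  unfolding dynamic_chromatic_number_def
proof (rule Least_equality)
  show "\<exists>c. dynamic_colouring r (verts n N b) (edge n N b) (r * n) c"
    using dynamic_colouring_block_colour assms by blast
qed (use dynamic_colouring_lower_bound assms in auto)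

theorem theorem1p3:
  fixes r n \<delta> :: nat
  assumes "r \<ge> 2" and "n \<ge> 2" and "\<delta> \<ge> 2"
  shows "\<exists>(V :: nat set) E d. simple_graph V E \<and> regular V E d \<and> d > \<delta>
           \<and> chromatic_number V E = n
           \<and> dynamic_chromatic_number r V E = r * chromatic_number V E"
proof -
  \<comment> \<open>A single \<open>t\<close> dominates all the lower bounds required of
    \<open>N\<close> and \<open>b\<close>.\<close>
  define t where "t = n * 2 ^ (r * n) * n + r + \<delta>"
  \<comment> \<open>Then \<open>N - 1\<close> is \<open>n - 1 + t\<close>, so
    \<open>less_binomial_add\<close> with \<open>j = n - 2\<close> gives
    \<open>t < b\<close>.\<close>
  define N where "N = Suc (n - 1 + t)"
  define b where "b = (N - 1) choose (n - 1)"
  have "Suc (n - 2) = n - 1"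
    using assms(2) by simp
  then have "t < b"
    using less_binomial_add[of t "n - 2"] by (simp only: b_def N_def diff_Suc_1)
  then have b: "r \<le> b" "0 < b" "\<delta> < b"
    by (auto simp: t_def)
  have N: "n * 2 ^ (r * n) * n < N"
    by (simp add: N_def t_def)
  let ?V = "verts n N b" and ?E = "edge n N b"
  have graph: "simple_graph ?V ?E"
    by (rule simple_graph_edge)
  have "finite ?V"
    using graph by (rule simple_graphD)
  then obtain f :: "vertex \<Rightarrow> nat" where f: "inj_on f ?V"
    using finite_imp_inj_to_nat_seg by blast
  have chi: "chromatic_number ?V ?E = n"
    using assms(2) b(2) by (intro chromatic_number_edge) (auto simp: N_def)
  have chi_r: "dynamic_chromatic_number r ?V ?E = r * n"
    using assms b N by (intro dynamic_chromatic_number_edge) (auto simp: b_def)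
  have "\<delta> < 1 * b"
    using b(3) by simp
  also have "\<dots> \<le> n * b"
    using assms(2) by (intro mult_le_mono1) simp
  finally have d: "\<delta> < n * b" .
  have "regular ?V ?E (n * b)"
    using assms(2) by (intro regular_edge) (auto simp: b_def)
  then have "regular (f ` ?V) (image_edge f ?E) (n * b)"
    by (rule regular_image[OF graph f])
  moreover have "chromatic_number (f ` ?V) (image_edge f ?E) = n"
    using chi by (simp only: chromatic_number_image[OF graph f])
  moreover have "dynamic_chromatic_number r (f ` ?V) (image_edge f ?E) = r * n"
    using chi_r by (simp only: dynamic_chromatic_number_image[OF graph f])
  ultimately show ?thesis
    using d simple_graph_image[OF graph f]
    by (intro exI[of _ "f ` ?V"] exI[of _ "image_edge f ?E"] exI[of _ "n * b"]) simp
qed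

end
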